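(* Let $q=4$ and $n=1+2q^1+q^3+q^e+2q^{e+1}$, where $e$ is a positive integer. Then $$g_{n,q}\equiv X^{q^2}+S_e+X^2S_e^2+S_3S_e^3\pmod{X^{q^e}-X}.$$ If $2\mid e$ but $3\nmid e$, then $g_{n,q}$ is a permutation polynomial of $\mathbb F_{q^e}$.
   Context: For a prime power $q$ with $p=\operatorname{char}\mathbb F_q$ and an integer $n\ge 0$, $g_{n,q}\in\mathbb F_p[X]$ is the polynomial defined by the functional equation $\sum_{c\in\mathbb F_q}(X+c)^n=g_{n,q}(X^q-X)$. For each integer $a\ge 0$, $S_a=X+X^q+\cdots+X^{q^{a-1}}$ (with $S_0=0$). Products and powers of the $S_a$ are ordinary products and powers of polynomials. A polynomial over a finite field $F$ is a permutation polynomial of $F$ if it induces a bijection $F\to F$. *)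

theory Defs
  imports "Berlekamp_Zassenhaus.Finite_Field" "HOL-Number_Theory.Cong"
    "HOL-Computational_Algebra.Polynomial"
begin

text \<open>
  Throughout, \<open>\<bbbF>\<^sub>q\<close> is an arbitrary type \<open>'k\<close> of class \<open>finite_field\<close>, with \<open>q = CARD('k)\<close>,
  and its prime field \<open>\<bbbF>\<^sub>p\<close>, where \<open>p = CHAR('k)\<close>, is the type \<open>'k ring_char mod_ring\<close>.
\<close>

definition of_prime_field :: "'p::prime_card mod_ring \<Rightarrow> 'a::field" where
  "of_prime_field x = of_int (to_int_mod_ring x)"

text \<open>
  \<^const>\<open>of_prime_field\<close> is a ring homomorphism only if \<open>CHAR('a) = CARD('p)\<close>, in which case it is the
  unique embedding of \<open>\<bbbF>\<^sub>p\<close> into the field \<open>'a\<close>.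
\<close>

text \<open>
  The defining identity of \<open>g\<^bsub>n,q\<^esub>\<close> lives in \<open>\<bbbF>\<^sub>q[X]\<close>; it has exactly one solution with coefficients in
  \<open>\<bbbF>\<^sub>p\<close>, because its left-hand side is invariant under the Frobenius and under all \<open>X \<mapsto> X + c\<close>.
\<close>

definition g_poly :: "'k::finite_field itself \<Rightarrow> nat \<Rightarrow> 'k ring_char mod_ring poly" where
  "g_poly _ n = (THE g.
     (\<Sum>c\<in>(UNIV :: 'k set). [:c, 1:] ^ n) =
       pcompose (map_poly of_prime_field g) (monom 1 (CARD('k)) - monom 1 1))"

definition S_poly :: "nat \<Rightarrow> nat \<Rightarrow> 'a::comm_ring_1 poly" where
  "S_poly q a = (\<Sum>i<a. monom 1 (q ^ i))"

definition permutation_poly :: "'a::finite_field poly \<Rightarrow> bool" where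
  "permutation_poly f \<longleftrightarrow> bij (poly f)"

end

theory Submission
  imports Defs
begin

text \<open>
  Let \<open>q = 4\<close>. The exponent \<open>n\<close> is a sum of seven powers of \<open>q\<close>, so \<open>(X + c)\<^sup>n\<close> is a product of
  seven factors \<open>(X + c)\<close> raised to a power \<open>q\<^sup>a\<close>. With \<open>Y = X\<^sup>q - X\<close>, such a factor equals
  \<open>X + c + S\<^sub>a(Y)\<close>, because \<open>c\<close> is fixed by the Frobenius and \<open>S\<^sub>a(X\<^sup>q - X)\<close> telescopes to
  \<open>X\<^bsup>q^a\<^esup> - X\<close> (\<open>power_CARD_power_linear\<close>). Hence
  \<open>\<Sum>\<^sub>c (X + c)\<^sup>n\<close> is the sum over \<open>c\<close> of a septic polynomial in \<open>Z = X + c\<close> whose coefficients are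
  polynomials in \<open>Y\<close>. Among the power sums \<open>\<Sum>\<^sub>c (X + c)\<^sup>k\<close> with \<open>1 \<le> k \<le> 7\<close> only those for
  \<open>k = 3, 6, 7\<close> survive, with values \<open>1, 1, Y\<close> (\<open>F4_power_sums\<close>). Reading off three coefficients
  gives \<open>g\<close> in closed form (\<open>g_poly_F4\<close>), and \<open>S\<^sub>e\<^sub>+\<^sub>1 = S\<^sub>e + X\<^bsup>q^e\<^esup> \<equiv> S\<^sub>e + X\<close> turns this form
  into the asserted one (\<open>g_poly_F4_cong\<close>).

  On the field with \<open>q\<^sup>e\<close> elements, \<open>S\<^sub>e\<close> is the trace \<open>T\<close> to the field with four elements. For even
  \<open>e\<close> the trace vanishes on that subfield, and this makes \<open>g\<close> preserve \<open>T\<close>. It is therefore enough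
  that \<open>g\<close> be injective on each fibre of \<open>T\<close>. On \<open>T = 0\<close> it is \<open>x \<mapsto> x\<^bsup>16\<^esup>\<close>. On \<open>T = t \<noteq> 0\<close> we have
  \<open>t\<^sup>3 = 1\<close>, and \<open>g\<close> becomes the affine map \<open>x \<mapsto> t + t\<^sup>2x\<^sup>2 + x + x\<^sup>4\<close>, so a collision gives a root
  \<open>u\<close> of \<open>u\<^sup>4 + t\<^sup>2u\<^sup>2 + u\<close>. Every such root satisfies \<open>u\<^bsup>16\<^esup> + u\<^sup>4 + u = 0\<close>, lies
  in the field with \<open>4\<^sup>3\<close> elements, and vanishes when \<open>3\<close> does not divide \<open>e\<close>
  (\<open>additive_quartic_no_root\<close>).
\<close>

section \<open>Characteristic and prime field\<close>

lemma add_self_CHAR_2: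
  assumes "CHAR('a::ring_1) = 2"
  shows "x + x = (0 :: 'a)"
  using minus_CHAR_2[OF assms, of x x] by simp

lemma add_self_left_CHAR_2:
  assumes "CHAR('a::ring_1) = 2"
  shows "x + (x + y) = (y :: 'a)"
  by (simp add: add_self_CHAR_2[OF assms] flip: add.assoc)

lemma sum_power2_CHAR_2:
  fixes f :: "'i \<Rightarrow> 'r::comm_semiring_1"
  assumes "CHAR('r) = 2"
  shows "sum f A ^ 2 = (\<Sum>i\<in>A. f i ^ 2)"
  by (rule freshmans_dream_sum) (simp_all add: assms)

lemma field_hom_of_prime_field:
  assumes "CHAR('a::field) = CARD('p::prime_card)"
  shows "field_hom (of_prime_field :: 'p mod_ring \<Rightarrow> 'a)"
proof
  fix x y :: "'p mod_ring"
  show "of_prime_field (x + y) = (of_prime_field x + of_prime_field y :: 'a)"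
    by (simp add: of_prime_field_def to_int_mod_ring_add flip: assms)
  show "of_prime_field (x * y) = (of_prime_field x * of_prime_field y :: 'a)"
    by (simp add: of_prime_field_def to_int_mod_ring_mult flip: assms)
qed (simp_all add: of_prime_field_def)

lemma CHAR_eq_of_CARD_eq_prime_power:
  assumes "prime p" "CARD('a::finite_field) = p ^ m"
  shows "CHAR('a) = p"
proof -
  have "CHAR('a) dvd CARD('a)" by (rule CHAR_dvd_CARD)
  moreover have "prime CHAR('a)" by simp
  ultimately show ?thesis using assms
    by (metis prime_dvd_power primes_dvd_imp_eq)
qed

lemma CHAR_eq_2_of_CARD_eq_4_power:
  assumes "CARD('a::finite_field) = 4 ^ m"
  shows "CHAR('a) = 2"
proof -
  have "CARD('a) = 2 ^ (2 * m)" by (simp add: assms power_mult)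
  then show ?thesis
    by (rule CHAR_eq_of_CARD_eq_prime_power[rotated]) simp
qed
section \<open>The defining equation of \<open>g\<close>\<close>

lemma degree_Artin_Schreier:
  assumes "q > 1"
  shows "degree (monom 1 q - monom 1 1 :: 'a::comm_ring_1 poly) = q"
  using assms by (intro antisym degree_le le_degree) (auto simp: coeff_monom)

lemma CARD_finite_field_gt_1: "CARD('k::finite_field) > 1"
  using card_mono[of "UNIV :: 'k set" "{0, 1}"] by simp

text \<open>
  The solution of the defining equation is unique because substituting a nonconstant polynomial is
  injective, as is the embedding of the prime field. So to compute \<open>g\<close> it suffices to exhibit a
  solution.
\<close>
lemma g_poly_eqI:
  fixes G :: "'k::finite_field ring_char mod_ring poly" and Fq :: "'k itself"
  assumes "(\<Sum>c\<in>(UNIV :: 'k set). [:c, 1:] ^ n) =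
    pcompose (map_poly of_prime_field G) (monom 1 (CARD('k)) - monom 1 1)"
  shows "g_poly Fq n = G"
  unfolding g_poly_def
proof (rule the_equality)
  show "(\<Sum>c\<in>(UNIV :: 'k set). [:c, 1:] ^ n) =
    pcompose (map_poly of_prime_field G) (monom 1 (CARD('k)) - monom 1 1)" by fact
next
  fix H :: "'k ring_char mod_ring poly"
  let ?Y = "monom 1 (CARD('k)) - monom 1 1 :: 'k poly"
  interpret field_hom "of_prime_field :: 'k ring_char mod_ring \<Rightarrow> 'k"
    by (rule field_hom_of_prime_field) simp
  interpret P: map_poly_inj_idom_hom "of_prime_field :: 'k ring_char mod_ring \<Rightarrow> 'k" ..
  assume "(\<Sum>c\<in>(UNIV :: 'k set). [:c, 1:] ^ n) = pcompose (map_poly of_prime_field H) ?Y"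
  with assms have "pcompose (map_poly of_prime_field (H - G)) ?Y = 0"
    by (simp add: pcompose_diff P.hom_minus)
  moreover have "CARD('k) > 1"
    by (rule CARD_finite_field_gt_1)
  then have "degree ?Y > 0" by (subst degree_Artin_Schreier) simp_all
  ultimately have "map_poly of_prime_field (H - G) = (0 :: 'k poly)"
    by (rule pcompose_eq_0)
  then show "H = G" by simp
qed

section \<open>Frobenius powers of linear polynomials\<close>

lemma pcompose_power: "pcompose (p ^ n) r = pcompose p r ^ n"
  for p r :: "'a::comm_semiring_1 poly"
  by (induction n) (simp_all add: pcompose_mult pcompose_1)

text \<open>
  By the Frobenius, \<open>(X\<^sup>q - X)\<^bsup>q^i\<^esup> = X\<^bsup>q^(i+1)\<^esup> - X\<^bsup>q^i\<^esup>\<close>, so the sum defining \<open>S\<^sub>a\<close> telescopes.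
\<close>
lemma pcompose_S_poly:
  assumes "prime CHAR('a::comm_ring_1)" "q = CHAR('a) ^ m"
  shows "pcompose (S_poly q a) (monom 1 q - monom 1 1) = monom 1 (q ^ a) - (monom 1 1 :: 'a poly)"
proof (induction a)
  case (Suc a)
  have X: "pcompose (monom 1 k) r = (r ^ k :: 'a poly)" for k r
    by (simp add: monom_altdef pcompose_power pcompose_pCons)
  have p: "prime CHAR('a poly)" "q ^ a = CHAR('a poly) ^ (m * a)"
    using assms by (simp_all add: power_mult)
  have "(monom 1 q - monom 1 1) ^ q ^ a + monom 1 1 ^ q ^ a = (monom 1 q ^ q ^ a :: 'a poly)"
    by (subst freshmans_dream'[OF p, symmetric]) simp
  then have "(monom 1 q - monom 1 1) ^ q ^ a = monom 1 (q ^ Suc a) - (monom 1 (q ^ a) :: 'a poly)"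
    by (simp add: monom_power mult.commute algebra_simps)
  with Suc show ?case by (simp add: S_poly_def pcompose_add X)
qed (simp add: S_poly_def)

text \<open>
  Both sides are \<open>X\<^bsup>q^a\<^esup> + c\<close>. The right-hand side displays this as a shift of \<open>X + c\<close> by a polynomial
  in \<open>X\<^sup>q - X\<close> that is the same for all \<open>c\<close>, so that sums over \<open>c\<close> reduce to power sums.
\<close>
lemma power_CARD_power_linear:
  fixes c :: "'k::finite_field"
  assumes "CARD('k) = CHAR('k) ^ m" "q = CARD('k)"
  shows "[:c, 1:] ^ (q ^ a) = [:c, 1:] + pcompose (S_poly q a) (monom 1 q - monom 1 1)"
proof -
  have p: "prime CHAR('k poly)" "q ^ a = CHAR('k poly) ^ (m * a)"
    using assms by (simp_all add: power_mult)
  have "[:c, 1:] = [:c:] + monom 1 1" by (simp add: monom_altdef)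
  then have "[:c, 1:] ^ (q ^ a) = ([:c:] + monom 1 1) ^ (q ^ a)" by simp
  also have "\<dots> = [:c:] ^ (q ^ a) + monom 1 1 ^ (q ^ a)" by (rule freshmans_dream'[OF p])
  also have "[:c:] ^ (q ^ a) = [:c:]"
    using finite_field_power_card_power_eq_same[of "q ^ a" a c] assms(2)
    by (simp add: poly_const_pow)
  also have "[:c:] + monom 1 1 ^ (q ^ a) = [:c, 1:] + (monom 1 (q ^ a) - monom 1 1)"
    by (simp add: monom_power monom_altdef)
  also have "monom 1 (q ^ a) - monom 1 1 = pcompose (S_poly q a) (monom 1 q - monom 1 1 :: 'k poly)"
    using assms by (subst pcompose_S_poly[where m = m]) simp_all
  finally show ?thesis .
qed

section \<open>Power sums over the field with four elements\<close>

text \<open>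
  Multiplication by \<open>w\<close> permutes the field and multiplies the sum by \<open>w\<^sup>j \<noteq> 1\<close>.
\<close>
lemma sum_UNIV_power_eq_0:
  fixes w :: "'k::finite_field"
  assumes "w \<noteq> 0" "w ^ j \<noteq> 1"
  shows "(\<Sum>c\<in>(UNIV :: 'k set). c ^ j) = 0"
proof -
  have "(\<Sum>c\<in>(UNIV :: 'k set). c ^ j) = (\<Sum>c\<in>UNIV. (w * c) ^ j)"
    by (rule sum.reindex_bij_witness[of _ "\<lambda>c. w * c" "\<lambda>c. c / w"]) (use assms in auto)
  also have "\<dots> = w ^ j * (\<Sum>c\<in>UNIV. c ^ j)"
    by (simp add: power_mult_distrib sum_distrib_left)
  finally have "(1 - w ^ j) * (\<Sum>c\<in>(UNIV :: 'k set). c ^ j) = 0" by (simp add: algebra_simps)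
  with assms show ?thesis by simp
qed

lemma sum_UNIV_power_card_minus_1:
  "(\<Sum>c\<in>(UNIV :: 'k::finite_field set). c ^ (CARD('k) - 1)) = -1"
proof -
  have one: "c ^ (CARD('k) - 1) = 1" if "c \<noteq> 0" for c :: 'k
  proof -
    have "c * c ^ (CARD('k) - 1) = c ^ CARD('k)" by (simp flip: power_Suc)
    then show ?thesis using that by (simp add: finite_field_power_card_eq_same)
  qed
  have gt: "CARD('k) > 1"
    by (rule CARD_finite_field_gt_1)
  have "(\<Sum>c\<in>(UNIV :: 'k set). c ^ (CARD('k) - 1)) = (\<Sum>c\<in>UNIV - {0::'k}. c ^ (CARD('k) - 1))"
    by (rule sum.mono_neutral_right) (use gt in auto)
  also have "\<dots> = (\<Sum>c\<in>UNIV - {0::'k}. 1)"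
    by (rule sum.cong) (use one in auto)
  also have "\<dots> = of_nat (CARD('k) - 1)"
    by (simp add: card_Diff_subset)
  also have "\<dots> = - 1"
  proof -
    have "(of_nat CARD('k) :: 'k) = 0" by (simp add: of_nat_eq_0_iff_char_dvd CHAR_dvd_CARD)
    then show ?thesis by (simp add: of_nat_diff)
  qed
  finally show ?thesis .
qed

text \<open>
  Exponents up to \<open>3\<close> come down to the power sums \<open>\<Sum>\<^sub>c c\<^sup>k\<close> of the field elements, of which only
  \<open>\<Sum>\<^sub>c c\<^sup>3 = -1 = 1\<close> is nonzero. Higher exponents reduce to these because \<open>Z\<^sup>4 = Z + Y\<close> for each
  \<open>Z = X + c\<close>.
\<close>
lemma F4_power_sums:
  assumes card: "CARD('k::finite_field) = 4"
  defines "Z \<equiv> \<lambda>c::'k. [:c, 1:]" and "Y \<equiv> monom 1 4 - monom 1 1"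
  shows "(\<Sum>c\<in>UNIV. Z c) = 0" "(\<Sum>c\<in>UNIV. Z c ^ 2) = 0" "(\<Sum>c\<in>UNIV. Z c ^ 3) = 1"
    "(\<Sum>c\<in>UNIV. Z c ^ 5) = 0" "(\<Sum>c\<in>UNIV. Z c ^ 6) = 1" "(\<Sum>c\<in>UNIV. Z c ^ 7) = Y"
proof -
  have char: "CHAR('k) = 2"
    by (rule CHAR_eq_2_of_CARD_eq_4_power[of 1]) (simp add: card)
  let ?X = "monom 1 1 :: 'k poly"
  have two: "(2 :: 'k poly) = 0" 
    using of_nat_CHAR[where ?'a = "'k poly"] char by simp
  have "(4 :: 'k poly) = 2 * 2" by simp
  also have "\<dots> = 0" by (simp only: two mult_zero_left)
  finally have four: "(4 :: 'k poly) = 0" .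
  have "\<exists>w. w \<notin> {0, 1 :: 'k}"
  proof (rule ccontr)
    assume "\<not> ?thesis"
    then have "UNIV = {0, 1 :: 'k}" by auto
    then have "CARD('k) = card {0, 1 :: 'k}" by (rule arg_cong)
    with card show False by simp
  qed
  \<comment> \<open>multiplication by such a \<open>w\<close> kills the first and second power sums, as \<open>w\<close> has order \<open>3\<close>\<close>
  then obtain w :: 'k where w: "w \<noteq> 0" "w \<noteq> 1" by auto
  have "w ^ 4 = w" using finite_field_power_card_eq_same[of w] card by simp
  moreover have "w ^ 4 = (w ^ 2) ^ 2" by (simp add: eval_nat_numeral)
  ultimately have "w ^ 2 \<noteq> 1" using w(2) by (metis power_one)
  then have s: "(\<Sum>c\<in>(UNIV :: 'k set). c) = 0" "(\<Sum>c\<in>(UNIV :: 'k set). c ^ 2) = 0"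
    using sum_UNIV_power_eq_0[of w 1] sum_UNIV_power_eq_0[of w 2] w by auto
  have s3: "(\<Sum>c\<in>(UNIV :: 'k set). c ^ 3) = 1"
    using sum_UNIV_power_card_minus_1[where ?'k = 'k] card uminus_CHAR_2[OF char, of 1] by simp
  have const: "(\<Sum>c\<in>(UNIV :: 'k set). [:f c:]) = [:\<Sum>c\<in>UNIV. f c:]" for f
    by (intro poly_eqI) (simp add: coeff_sum coeff_pCons split: nat.split)
  have Z: "Z c = [:c:] + ?X" for c by (simp add: Z_def monom_altdef)
  have Z4: "Z c ^ 4 = Z c + Y" for c
  proof -
    have "monom 1 1 = [:0, 1 :: 'k:]" by (simp add: monom_altdef)
    then have "pcompose (monom 1 1) Y = Y" by (simp only: pcompose_pCons) simp
    moreover have "S_poly 4 1 = (monom 1 1 :: 'k poly)" by (simp add: S_poly_def)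
    moreover have "Z c ^ (4 ^ 1) = Z c + pcompose (S_poly 4 1) Y"
      unfolding Z_def Y_def by (rule power_CARD_power_linear[where m = 2]) (simp_all add: card char)
    ultimately show ?thesis by (simp only: power_one_right)
  qed
  show p1: "(\<Sum>c\<in>UNIV. Z c) = 0"
    by (simp add: Z sum.distrib const s card four)
  show p2: "(\<Sum>c\<in>UNIV. Z c ^ 2) = 0"
    using sum_power2_CHAR_2[where f = Z and A = UNIV] p1 char by simp
  have Z3: "Z c ^ 3 = [:c ^ 3:] + [:c ^ 2:] * (3 * ?X) + [:c:] * (3 * ?X ^ 2) + ?X ^ 3" for c
  proof -
    have "(x + y) ^ 3 = x ^ 3 + x ^ 2 * (3 * y) + x * (3 * y ^ 2) + y ^ 3" for x y :: "'k poly"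
      by (simp add: power3_eq_cube power2_eq_square algebra_simps)
    then show ?thesis by (simp only: Z poly_const_pow)
  qed
  show p3: "(\<Sum>c\<in>UNIV. Z c ^ 3) = 1"
    unfolding Z3 sum.distrib sum_distrib_right[symmetric] const s s3
    by (simp only: sum_constant card of_nat_numeral four) (simp add: one_pCons)
  have "Z c ^ 5 = Z c * (Z c + Y)" for c
    unfolding Z4[symmetric] by (simp flip: power_Suc)
  then show "(\<Sum>c\<in>UNIV. Z c ^ 5) = 0"
    by (simp add: distrib_left sum.distrib p1 p2 flip: sum_distrib_right power2_eq_square)
  have "Z c ^ 6 = Z c ^ 2 * (Z c + Y)" for c
    unfolding Z4[symmetric] by (simp flip: power_add)
  moreover have "Z c ^ 2 * Z c = Z c ^ 3" for c
    by (simp add: power2_eq_square power3_eq_cube)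
  ultimately show "(\<Sum>c\<in>UNIV. Z c ^ 6) = 1"
    by (simp add: distrib_left sum.distrib p3 p2 flip: sum_distrib_right)
  have "Z c ^ 7 = Z c ^ 3 * (Z c + Y)" for c
    unfolding Z4[symmetric] by (simp flip: power_add)
  moreover have "(\<Sum>c\<in>(UNIV :: 'k set). Y) = 0"
    by (simp only: sum_constant card of_nat_numeral four) simp
  moreover have "Z c ^ 3 * Z c = Z c + Y" for c
    unfolding Z4[symmetric] by (simp add: eval_nat_numeral)
  ultimately show "(\<Sum>c\<in>UNIV. Z c ^ 7) = Y"
    by (simp add: distrib_left sum.distrib p3 p1 flip: sum_distrib_right)
qed

text \<open>
  The coefficient of \<open>z\<^sup>4\<close> is attached to \<open>(z\<^sup>2)\<^sup>2\<close> so that the sum over \<open>z\<close> can be evaluated as the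
  square of a power sum.
\<close>
lemma septic_expand:
  fixes z :: "'r::comm_ring_1"
  shows "z * (z ^ 2 + a) * (z + b) * (z + c) * (z ^ 2 + d) = z ^ 7 + z ^ 6 * (b + c)
    + z ^ 5 * (a + d + b * c) + (z ^ 2) ^ 2 * ((a + d) * (b + c))
    + z ^ 3 * (a * d + (a + d) * (b * c)) + z ^ 2 * (a * d * (b + c)) + z * (a * d * (b * c))"
  by (simp add: eval_nat_numeral algebra_simps)

text \<open>
  In characteristic \<open>2\<close> the squared factors are \<open>Z\<^sup>2 + A\<^sup>2\<close> and \<open>Z\<^sup>2 + D\<^sup>2\<close>. The three summands on
  the right are the contributions of the coefficients of \<open>Z\<^sup>7\<close>, \<open>Z\<^sup>6\<close> and \<open>Z\<^sup>3\<close>.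
\<close>
lemma F4_septic_sum:
  fixes A B C D :: "'k::finite_field poly"
  assumes card: "CARD('k) = 4"
  shows "(\<Sum>c\<in>UNIV. [:c, 1:] * ([:c, 1:] + A) ^ 2 * ([:c, 1:] + B)
      * ([:c, 1:] + C) * ([:c, 1:] + D) ^ 2)
    = monom 1 4 - monom 1 1 + (B + C) + (A ^ 2 * D ^ 2 + (A ^ 2 + D ^ 2) * (B * C))"
proof -
  have char: "CHAR('k) = 2"
    by (rule CHAR_eq_2_of_CARD_eq_4_power[of 1]) (simp add: card)
  have sq: "(p + r) ^ 2 = p ^ 2 + r ^ 2" for p r :: "'k poly"
    by (rule freshmans_dream) (simp_all add: char)
  note p = F4_power_sums[OF card]
  have "(\<Sum>c\<in>UNIV. ([:c, 1::'k:] ^ 2) ^ 2) = (\<Sum>c\<in>UNIV. [:c, 1:] ^ 2) ^ 2"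
    by (rule sum_power2_CHAR_2[symmetric]) (simp add: char)
  then have p4: "(\<Sum>c\<in>UNIV. ([:c, 1::'k:] ^ 2) ^ 2) = 0" using p(2) by simp
  show ?thesis
    unfolding sq septic_expand sum.distrib sum_distrib_right[symmetric] p p4 by simp
qed

section \<open>The polynomial \<open>g\<close> for the field with four elements\<close>

lemma map_poly_S_poly:
  assumes "field_hom (h :: 'a::field \<Rightarrow> 'b::field)"
  shows "map_poly h (S_poly q a) = S_poly q a"
proof -
  interpret field_hom h by fact
  interpret P: map_poly_inj_idom_hom h ..
  show ?thesis by (simp add: S_poly_def P.hom_sum)
qed

text \<open>
  Each summand of \<open>n\<close> gives one factor: the exponents \<open>1\<close>, \<open>2\<cdot>4\<close>, \<open>4\<^sup>3\<close>, \<open>4\<^sup>e\<close> and \<open>2\<cdot>4\<^bsup>e+1\<^esup>\<close>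
  contribute \<open>Z\<close>, \<open>(Z + S\<^sub>1)\<^sup>2\<close>, \<open>Z + S\<^sub>3\<close>, \<open>Z + S\<^sub>e\<close> and \<open>(Z + S\<^sub>e\<^sub>+\<^sub>1)\<^sup>2\<close>, where \<open>S\<^sub>1 = X\<close>
  and all \<open>S\<^sub>a\<close> are evaluated at \<open>Y = X\<^sup>4 - X\<close>.
\<close>
lemma g_poly_F4:
  fixes Fq :: "'k::finite_field itself"
  assumes card: "CARD('k) = 4" and n: "n = 1 + 2 * 4 ^ 1 + 4 ^ 3 + 4 ^ e + 2 * 4 ^ (e + 1)"
  shows "g_poly Fq n = monom 1 1 + (S_poly 4 3 + S_poly 4 e)
    + (monom 1 1 ^ 2 * S_poly 4 (e + 1) ^ 2
       + (monom 1 1 ^ 2 + S_poly 4 (e + 1) ^ 2) * (S_poly 4 3 * S_poly 4 e))" (is "_ = ?G")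
proof (rule g_poly_eqI)
  let ?h = "of_prime_field :: 'k ring_char mod_ring \<Rightarrow> 'k"
  have hom: "field_hom ?h" by (rule field_hom_of_prime_field) simp
  interpret field_hom ?h by (rule hom)
  interpret P: map_poly_inj_idom_hom ?h ..
  have char: "CHAR('k) = 2"
    by (rule CHAR_eq_2_of_CARD_eq_4_power[of 1]) (simp add: card)
  define Y where "Y = monom 1 4 - (monom 1 1 :: 'k poly)"
  define S where "S a = pcompose (S_poly 4 a) Y" for a
  have lin: "[:c, 1:] ^ (4 ^ a) = [:c, 1:] + S a" for c :: 'k and a
    unfolding S_def Y_def by (rule power_CARD_power_linear[where m = 2]) (simp_all add: card char)
  have "monom 1 1 = [:0, 1 :: 'k:]" by (simp add: monom_altdef)
  then have X: "pcompose (monom 1 1) Y = Y" by (simp only: pcompose_pCons) simp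
  have "S_poly 4 1 = (monom 1 1 :: 'k poly)" by (simp add: S_poly_def)
  then have S1: "S 1 = Y" by (simp only: S_def X)
  have "(\<Sum>c\<in>(UNIV :: 'k set). [:c, 1:] ^ n) = (\<Sum>c\<in>(UNIV :: 'k set).
      [:c, 1:] * ([:c, 1:] + Y) ^ 2 * ([:c, 1:] + S 3) * ([:c, 1:] + S e) * ([:c, 1:] + S (e + 1)) ^ 2)"
  proof (rule sum.cong)
    fix c :: 'k
    have "[:c, 1:] ^ n = [:c, 1:] * ([:c, 1:] ^ (4 ^ 1)) ^ 2 * [:c, 1:] ^ (4 ^ 3)
        * [:c, 1:] ^ (4 ^ e) * ([:c, 1:] ^ (4 ^ (e + 1))) ^ 2"
      unfolding n power_add power_one_right mult.commute[of 2] power_mult ..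
    then show "[:c, 1:] ^ n = [:c, 1:] * ([:c, 1:] + Y) ^ 2 * ([:c, 1:] + S 3) * ([:c, 1:] + S e)
        * ([:c, 1:] + S (e + 1)) ^ 2"
      unfolding lin S1 .
  qed simp
  also have "\<dots> = Y + (S 3 + S e) + (Y ^ 2 * S (e + 1) ^ 2 + (Y ^ 2 + S (e + 1) ^ 2) * (S 3 * S e))"
    unfolding F4_septic_sum[OF card] Y_def ..
  also have "\<dots> = pcompose (map_poly ?h ?G) Y"
    unfolding P.hom_add P.hom_mult P.hom_power map_poly_S_poly[OF hom] map_poly_hom_monom hom_one
      pcompose_add pcompose_mult pcompose_power X S_def ..
  finally show "(\<Sum>c\<in>(UNIV :: 'k set). [:c, 1:] ^ n)
      = pcompose (map_poly ?h ?G) (monom 1 (CARD('k)) - monom 1 1)"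
    unfolding card Y_def .
qed

text \<open>
  Substituting \<open>S\<^sub>e\<^sub>+\<^sub>1 \<equiv> S\<^sub>e + X\<close> into the closed form, \<open>X\<^sup>2 + S\<^sub>e\<^sub>+\<^sub>1\<^sup>2\<close> collapses to \<open>S\<^sub>e\<^sup>2\<close>, and in
  \<open>X + S\<^sub>3 + X\<^sup>4\<close> only \<open>X\<^bsup>16\<^esup>\<close> survives.
\<close>
lemma g_poly_F4_cong:
  fixes Fq :: "'k::finite_field itself"
  assumes card: "CARD('k) = 4" and n: "n = 1 + 2 * 4 ^ 1 + 4 ^ 3 + 4 ^ e + 2 * 4 ^ (e + 1)"
  shows "[g_poly Fq n = monom 1 (4 ^ 2) + S_poly 4 e + monom 1 2 * S_poly 4 e ^ 2
            + S_poly 4 3 * S_poly 4 e ^ 3] (mod monom 1 (4 ^ e) - monom 1 1)"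
proof -
  let ?X = "monom 1 1 :: 'k ring_char mod_ring poly"
  let ?M = "monom 1 (4 ^ e) - ?X"
  let ?S = "S_poly 4 e :: 'k ring_char mod_ring poly" and ?S3 = "S_poly 4 3 :: 'k ring_char mod_ring poly"
  have char: "CHAR('k) = 2"
    by (rule CHAR_eq_2_of_CARD_eq_4_power[of 1]) (simp add: card)
  then have char': "CHAR('k ring_char mod_ring poly) = 2" by simp
  have double: "p + p = 0" for p :: "'k ring_char mod_ring poly"
    by (rule add_self_CHAR_2[OF char'])
  have cancel: "p + (p + r) = r" for p r :: "'k ring_char mod_ring poly"
    by (rule add_self_left_CHAR_2[OF char'])
  have sq: "(?S + ?X) ^ 2 = ?S ^ 2 + ?X ^ 2"
    by (rule freshmans_dream) (simp_all add: char)
  have "[monom 1 (4 ^ e) = ?X] (mod ?M)" by (simp add: cong_iff_dvd_diff)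
  then have "[?S + monom 1 (4 ^ e) = ?S + ?X] (mod ?M)" by (intro cong_add cong_refl)
  then have S: "[S_poly 4 (e + 1) = ?S + ?X] (mod ?M)" by (simp add: S_poly_def)
  have S3: "?S3 = ?X + monom 1 4 + monom 1 (4 ^ 2)" by (simp add: S_poly_def eval_nat_numeral)
  have X2: "?X ^ 2 = monom 1 2" and X4: "monom 1 2 ^ 2 = (monom 1 4 :: 'k ring_char mod_ring poly)"
    by (simp_all add: monom_power)
  have "[?X + (?S3 + ?S) + (?X ^ 2 * S_poly 4 (e + 1) ^ 2 + (?X ^ 2 + S_poly 4 (e + 1) ^ 2) * (?S3 * ?S))
      = ?X + (?S3 + ?S) + (?X ^ 2 * (?S + ?X) ^ 2 + (?X ^ 2 + (?S + ?X) ^ 2) * (?S3 * ?S))] (mod ?M)"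
    by (intro cong_add cong_mult cong_pow cong_refl S)
  also have "?X ^ 2 + (?S + ?X) ^ 2 = ?S ^ 2"
    unfolding sq by (simp add: cancel add.commute)
  also have "?X ^ 2 * (?S + ?X) ^ 2 = monom 1 2 * ?S ^ 2 + monom 1 4"
    unfolding sq X2 by (simp add: distrib_left X4 flip: power2_eq_square)
  also have "?X + (?S3 + ?S) + (monom 1 2 * ?S ^ 2 + monom 1 4 + ?S ^ 2 * (?S3 * ?S))
      = (?X + ?S3 + monom 1 4) + ?S + monom 1 2 * ?S ^ 2 + ?S3 * ?S ^ 3"
    by (simp add: power2_eq_square power3_eq_cube ac_simps)
  also have "?X + ?S3 + monom 1 4 = monom 1 (4 ^ 2)"
    unfolding S3 by (simp add: ac_simps cancel double)
  finally show ?thesis unfolding g_poly_F4[OF assms] .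
qed

section \<open>The trace map\<close>

text \<open>
  If every \<open>x\<close> satisfies \<open>x\<^bsup>q^e\<^esup> = x\<close>, then evaluating \<open>S\<^sub>e\<close> is the trace to the subfield fixed by
  \<open>x \<mapsto> x\<^sup>q\<close>.
\<close>

lemma poly_S_poly: "poly (S_poly q a) x = (\<Sum>i<a. x ^ (q ^ i))"
  by (simp add: S_poly_def poly_sum poly_monom)

lemma poly_S_poly_add:
  fixes x y :: "'a::comm_ring_1"
  assumes "prime CHAR('a)" "q = CHAR('a) ^ m"
  shows "poly (S_poly q e) (x + y) = poly (S_poly q e) x + poly (S_poly q e) y"
  unfolding poly_S_poly sum.distrib[symmetric]
  by (intro sum.cong refl freshmans_dream') (use assms in \<open>auto simp flip: power_mult\<close>)

lemma poly_S_poly_power: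
  fixes x :: "'a::comm_ring_1"
  assumes "prime CHAR('a)" "r = CHAR('a) ^ l"
  shows "poly (S_poly q e) (x ^ r) = poly (S_poly q e) x ^ r"
  unfolding poly_S_poly freshmans_dream_sum'[OF assms] by (simp add: mult.commute flip: power_mult)

lemma poly_S_poly_power_q:
  fixes x :: "'a::comm_ring_1"
  assumes "x ^ (q ^ e) = x"
  shows "poly (S_poly q e) (x ^ q) = poly (S_poly q e) x"
proof -
  have "poly (S_poly q e) (x ^ q) = (\<Sum>i<e. x ^ (q ^ Suc i))"
    by (simp add: poly_S_poly power_mult)
  moreover have "(\<Sum>i<Suc e. x ^ (q ^ i)) = x + (\<Sum>i<e. x ^ (q ^ Suc i))"
    by (subst sum.lessThan_Suc_shift) simp
  ultimately show ?thesis using assms by (simp add: poly_S_poly)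
qed

lemma power_q_power_fixed: "x ^ (q ^ i) = x" if "x ^ q = x" for x :: "'a::monoid_mult"
  by (induction i) (simp_all add: power_mult that)

lemma poly_S_poly_scale:
  fixes t x :: "'a::comm_ring_1"
  assumes "t ^ q = t"
  shows "poly (S_poly q e) (t * x) = t * poly (S_poly q e) x"
  by (simp add: poly_S_poly power_mult_distrib power_q_power_fixed[OF assms] sum_distrib_left)

lemma poly_S_poly_const:
  fixes t :: "'a::comm_ring_1"
  assumes "t ^ q = t"
  shows "poly (S_poly q e) t = of_nat e * t"
  by (simp add: poly_S_poly power_q_power_fixed[OF assms])

section \<open>Injectivity on the fibres of the trace\<close>

text \<open>
  Applying the Frobenius \<open>u \<mapsto> u\<^sup>4\<close> to \<open>u\<^sup>4 = t\<^sup>2u\<^sup>2 + u\<close> and reducing by the same equation gives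
  \<open>u\<^bsup>16\<^esup> = u\<^sup>4 + u\<close>, in which \<open>t\<close> no longer appears. One further Frobenius gives \<open>u\<^bsup>64\<^esup> = u\<close>, so
  \<open>u\<^bsup>4^e\<^esup>\<close> depends only on \<open>e mod 3\<close>. If this residue is nonzero, \<open>u\<close> is fixed by \<open>u \<mapsto> u\<^bsup>16\<^esup>\<close>, and
  \<open>u = u\<^sup>4 + u\<close> forces \<open>u = 0\<close>.
\<close>
lemma additive_quartic_no_root:
  fixes t u :: "'a::idom"
  assumes char: "CHAR('a) = 2" and t: "t ^ 3 = 1" and u: "u ^ 4 = t ^ 2 * u ^ 2 + u"
    and e: "u ^ (4 ^ e) = u" "\<not> 3 dvd e"
  shows "u = 0"
proof -
  have double: "x + x = 0" for x :: 'a
    by (rule add_self_CHAR_2[OF char])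
  have cancel: "x + (x + y) = y" for x y :: 'a
    by (rule add_self_left_CHAR_2[OF char])
  have frob: "(x + y) ^ 4 = x ^ 4 + y ^ 4" for x y :: 'a
    by (rule freshmans_dream'[of _ 2]) (simp_all add: char)
  have sq: "(x + y) ^ 2 = x ^ 2 + y ^ 2" for x y :: 'a
    by (rule freshmans_dream) (simp_all add: char)
  have "t ^ 8 = t ^ 3 * t ^ 3 * t ^ 2" "t ^ 6 = t ^ 3 * t ^ 3"
    by (simp_all flip: power_add)
  then have t8: "t ^ 8 = t ^ 2" "t ^ 6 = 1" by (simp_all add: t)
  have "(u ^ 4) ^ 4 = t ^ 8 * (u ^ 4) ^ 2 + u ^ 4"
    by (subst u) (simp only: frob power_mult_distrib flip: power_mult, simp)
  moreover have "(u ^ 4) ^ 2 = t ^ 4 * u ^ 4 + u ^ 2"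
    by (subst u) (simp only: sq power_mult_distrib flip: power_mult, simp)
  moreover have "t ^ 8 * (t ^ 4 * u ^ 4 + u ^ 2) = t ^ 6 * u ^ 4 + t ^ 2 * u ^ 2"
    unfolding t8(1) by (simp add: distrib_left flip: power_add mult.assoc)
  moreover have "t ^ 6 * u ^ 4 + t ^ 2 * u ^ 2 + u ^ 4 = u ^ 4 + u"
    by (simp add: t8(2) u double cancel ac_simps)
  ultimately have "(u ^ 4) ^ 4 = u ^ 4 + u" by (simp only:)
  moreover have "u ^ (4 ^ 2) = (u ^ 4) ^ 4" by (simp flip: power_mult)
  ultimately have u16: "u ^ (4 ^ 2) = u ^ 4 + u" by (simp only:)
  have "u ^ (4 ^ 3) = (u ^ (4 ^ 2)) ^ 4" by (simp flip: power_mult)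
  also have "\<dots> = u ^ (4 ^ 2) + u ^ 4" unfolding u16 frob \<open>u ^ (4 ^ 2) = (u ^ 4) ^ 4\<close>[symmetric] ..
  also have "\<dots> = u" unfolding u16 by (simp add: double ac_simps)
  finally have u64: "u ^ (4 ^ 3) = u" .
  have "u ^ (4 ^ e) = (u ^ ((4 ^ 3) ^ (e div 3))) ^ (4 ^ (e mod 3))"
    by (metis mult_div_mod_eq power_add power_mult)
  also have "u ^ ((4 ^ 3) ^ (e div 3)) = u" by (rule power_q_power_fixed[OF u64])
  finally have r: "u ^ (4 ^ (e mod 3)) = u" using e(1) by simp
  have "e mod 3 = 1 \<or> e mod 3 = 2" using e(2) by presburger
  then have "u ^ (4 ^ 2) = u"
  proof
    assume "e mod 3 = 1"
    with r have "u ^ 4 = u" by simp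
    then show ?thesis by (rule power_q_power_fixed)
  next
    assume "e mod 3 = 2"
    with r show ?thesis by simp
  qed
  then have "u = u ^ 4 + u" using u16 by (rule trans[OF sym])
  then show ?thesis by simp
qed

text \<open>
  The map \<open>f\<close> preserves \<open>T\<close>: this is clear when \<open>T z = 0\<close>, and for \<open>t = T z \<noteq> 0\<close> the terms \<open>t\<close>,
  \<open>(tz)\<^sup>2\<close>, \<open>z\<close>, \<open>z\<^sup>4\<close> of \<open>f z\<close> have traces \<open>e t = 0\<close>, \<open>(t\<cdot>t)\<^sup>2 = t\<close>, \<open>t\<close>, \<open>t\<close>, with sum \<open>t\<close>. Hence
  colliding points lie in the same fibre of \<open>T\<close>, where \<open>f\<close> is affine over the field with two
  elements and only the kernel of its linear part matters.
\<close>
lemma inj_trace_fibred_map: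
  fixes f :: "'a::finite_field \<Rightarrow> 'a" and T :: "'a \<Rightarrow> 'a"
  assumes card: "CARD('a) = 4 ^ e" and e: "even e" "\<not> 3 dvd e"
  defines "T \<equiv> poly (S_poly 4 e)"
  assumes f: "\<And>x. f x = x ^ 16 + T x + x ^ 2 * T x ^ 2 + (x + x ^ 4 + x ^ 16) * T x ^ 3"
  shows "inj f"
proof (rule injI)
  fix x y assume eq: "f x = f y"
  have char: "CHAR('a) = 2"
    by (rule CHAR_eq_2_of_CARD_eq_4_power) (rule card)
  have double: "z + z = 0" for z :: 'a
    by (rule add_self_CHAR_2[OF char])
  have cancel: "z + (z + w) = w" for z w :: 'a
    by (rule add_self_left_CHAR_2[OF char])
  have fixed: "z ^ (4 ^ e) = z" for z :: 'a
    using finite_field_power_card_eq_same[of z] by (simp add: card)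
  have frob: "(z + w) ^ 2 ^ k = z ^ 2 ^ k + w ^ 2 ^ k" for z w :: 'a and k
    by (rule freshmans_dream') (simp_all add: char)
  have T_add: "T (z + w) = T z + T w" for z w
    unfolding T_def by (rule poly_S_poly_add[where m = 2]) (simp_all add: char)
  have T_sq: "T (z ^ 2) = T z ^ 2" for z
    unfolding T_def by (rule poly_S_poly_power[where l = 1]) (simp_all add: char)
  have T4: "T (z ^ 4) = T z" for z
    unfolding T_def by (rule poly_S_poly_power_q[OF fixed])
  have T_fixed: "T z ^ 4 = T z" for z
  proof -
    have "T (z ^ 4) = T z ^ 4"
      unfolding T_def by (rule poly_S_poly_power[where l = 2]) (simp_all add: char)
    then show ?thesis by (simp add: T4)
  qed
  have T16: "T (z ^ 16) = T z" for z
    using T4[of "z ^ 4"] by (simp add: T4 flip: power_mult)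
  have cube: "T z ^ 3 = 1" if "T z \<noteq> 0" for z
    using T_fixed[of z] that by (simp add: eval_nat_numeral)
  have f_nz: "f z = T z + (T z * z) ^ 2 + z + z ^ 4" if "T z \<noteq> 0" for z
    unfolding f cube[OF that] by (simp add: power_mult_distrib cancel ac_simps)
  have f_z: "f z = z ^ 16" if "T z = 0" for z
    using that by (simp add: f)
  have Tf: "T (f z) = T z" for z
  proof (cases "T z = 0")
    case False
    have "T (T z) = of_nat e * T z"
      unfolding T_def by (rule poly_S_poly_const) (rule T_fixed[unfolded T_def])
    also have "of_nat e = (0 :: 'a)"
      using e(1) by (simp add: of_nat_eq_0_iff_char_dvd char)
    finally have "T (T z) = 0" by simp
    moreover have "T (T z * z) = T z * T z"
      using poly_S_poly_scale[OF T_fixed, of e z z] unfolding T_def .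
    moreover have "(T z * T z) ^ 2 = T z ^ 4" by (simp add: eval_nat_numeral)
    ultimately show ?thesis
      unfolding f_nz[OF False] T_add T_sq T4 by (simp add: T_fixed double)
  qed (simp add: f_z T16)
  have T_eq: "T x = T y" using Tf[of x] Tf[of y] eq by simp
  have "x + y = 0"
  proof (cases "T y = 0")
    case True
    then have "x ^ 16 = y ^ 16" using eq T_eq by (simp add: f_z)
    then have "(x + y) ^ 2 ^ 4 = 0" using frob[of x y 4] by (simp add: double)
    then show ?thesis by simp
  next
    case False
    \<comment> \<open>\<open>u\<close> is the difference of \<open>x\<close> and \<open>y\<close>, written as a sum because the characteristic is \<open>2\<close>\<close>
    define u where "u = x + y"
    have "T y + (T y * x) ^ 2 + x + x ^ 4 = T y + (T y * y) ^ 2 + y + y ^ 4"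
      using eq f_nz[of x] f_nz[of y] False T_eq by simp
    then have "T y + (T y * x) ^ 2 + x + x ^ 4 + (T y + (T y * y) ^ 2 + y + y ^ 4) = 0"
      by (simp only: double)
    moreover have "x ^ 4 + y ^ 4 = u ^ 4" "x ^ 2 + y ^ 2 = u ^ 2"
      unfolding u_def using frob[of x y 2] frob[of x y 1] by simp_all
    moreover have "T y + (T y * x) ^ 2 + x + x ^ 4 + (T y + (T y * y) ^ 2 + y + y ^ 4)
        = T y ^ 2 * (x ^ 2 + y ^ 2) + (x + y) + (x ^ 4 + y ^ 4)"
      by (simp add: power_mult_distrib distrib_left cancel ac_simps)
    ultimately have "(T y ^ 2 * u ^ 2 + u) + u ^ 4 = 0" by (simp add: u_def)
    then have "u ^ 4 = T y ^ 2 * u ^ 2 + u"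
      by (metis add_eq_0_iff uminus_CHAR_2[OF char])
    then show ?thesis
      using additive_quartic_no_root[OF char cube[OF False] _ fixed e(2)] by (simp add: u_def)
  qed
  then show "x = y" by (metis add_eq_0_iff uminus_CHAR_2[OF char])
qed

theorem proposition3p6:
  fixes q n e :: nat
    and Fq :: "'k::finite_field itself"
  assumes "q = 4" and "CARD('k) = q"
    and "e > 0"
    and "n = 1 + 2 * q ^ 1 + q ^ 3 + q ^ e + 2 * q ^ (e + 1)"
  shows "[g_poly Fq n = monom 1 (q ^ 2) + S_poly q e + monom 1 2 * S_poly q e ^ 2
            + S_poly q 3 * S_poly q e ^ 3] (mod monom 1 (q ^ e) - monom 1 1)
       \<and> (CARD('a) = q ^ e \<longrightarrow> 2 dvd e \<longrightarrow> \<not> 3 dvd e \<longrightarrow>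
            permutation_poly (map_poly of_prime_field (g_poly Fq n) ::
              'a::finite_field poly))"
proof (intro conjI impI)
  let ?R = "monom 1 (q ^ 2) + S_poly q e + monom 1 2 * S_poly q e ^ 2
    + S_poly q 3 * S_poly q e ^ 3 :: 'k ring_char mod_ring poly"
  show cong: "[g_poly Fq n = ?R] (mod monom 1 (q ^ e) - monom 1 1)"
    using g_poly_F4_cong assms by blast
  assume card: "CARD('a) = q ^ e" and e: "2 dvd e" "\<not> 3 dvd e"
  have char: "CHAR('a) = 2"
    by (rule CHAR_eq_2_of_CARD_eq_4_power[of e]) (simp add: card assms(1))
  have char_k: "CHAR('k) = 2"
    by (rule CHAR_eq_2_of_CARD_eq_4_power[of 1]) (simp add: assms)
  let ?h = "of_prime_field :: 'k ring_char mod_ring \<Rightarrow> 'a"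
  have hom: "field_hom ?h" by (rule field_hom_of_prime_field) (simp add: char char_k)
  interpret field_hom ?h by (rule hom)
  interpret P: map_poly_inj_idom_hom ?h ..
  obtain p where p: "g_poly Fq n = ?R + (monom 1 (q ^ e) - monom 1 1) * p"
    using cong_sym[OF cong] unfolding cong_iff_lin by auto
  have "poly (map_poly ?h (g_poly Fq n)) x = x ^ 16 + poly (S_poly 4 e) x
      + x ^ 2 * poly (S_poly 4 e) x ^ 2 + (x + x ^ 4 + x ^ 16) * poly (S_poly 4 e) x ^ 3" for x
  proof -
    have "x ^ (4 ^ e) = x"
      using finite_field_power_card_eq_same[of x] by (simp add: card assms(1))
    moreover have "poly (S_poly 4 3) x = x + x ^ 4 + x ^ 16"
      by (simp add: poly_S_poly eval_nat_numeral)
    ultimately show ?thesis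
      unfolding p P.hom_add P.hom_mult P.hom_power P.hom_minus map_poly_S_poly[OF hom]
        map_poly_hom_monom hom_one assms(1)
      by (simp add: poly_monom)
  qed
  then have "inj (poly (map_poly ?h (g_poly Fq n)))"
    using inj_trace_fibred_map[of e "poly (map_poly ?h (g_poly Fq n))"] card e assms(1) by simp
  then show "permutation_poly (map_poly ?h (g_poly Fq n))"
    unfolding permutation_poly_def by (simp add: bij_def finite_UNIV_inj_surj)
qed

end
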